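(* Let $p$ be an odd prime and $d_1,d_2\in\{1,\dots,p^2-1\}$. Suppose the monomial function $X\mapsto X^{d_1}$ is GAPN over $\mathbb{F}_{p^2}$, and let $u\in\mathbb{F}_{p^2}^*$. Then the function \[G\colon\mathbb{F}_{p^2}\to\mathbb{F}_{p^2},\quad X\mapsto X^{d_1}+u\cdot X^{d_2}\] is GAPN if one of the following two conditions holds: (1) $d_2$ is odd and $u$ is not a square in $\mathbb{F}_{p^2}$; (2) $d_2$ is even and there exists an odd integer $N$ such that $p+1$ is a multiple of $N$, $d_2-d_1$ is a multiple of $N$, and $u$ is not an $N$-th power in $\mathbb{F}_{p^2}$.
   Context: $\mathbb{F}_{p^n}$ denotes the finite field with $p^n$ elements and $\mathbb{F}_{p^n}^*$ its multiplicative group. A function $G\colon\mathbb{F}_{p^n}\to\mathbb{F}_{p^n}$ is GAPN (generalized almost perfect nonlinear) if for all $a\in\mathbb{F}_{p^n}^*$ and $b\in\mathbb{F}_{p^n}$ the equation $\sum_{i\in\mathbb{F}_p}G(X+ia)=b$ has at most $p$ solutions $X\in\mathbb{F}_{p^n}$. *)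

theory Defs
  imports "HOL-Number_Theory.Number_Theory" "HOL-Library.Cardinality"
begin

text \<open>
  The finite field with \<open>p ^ n\<close> elements is a type \<open>'a\<close> of the classes
  \<open>field\<close> and \<open>finite\<close> with \<open>CARD('a) = p ^ n\<close>; then \<open>p = CHAR('a)\<close>.
\<close>

text \<open>
  In positive characteristic the image of the integers is the prime subfield; it is the copy of the
  field with \<open>CHAR('a)\<close> elements inside \<open>'a\<close>.
\<close>
definition prime_subfield :: "'a::{field,finite} set" where
  "prime_subfield = range of_int"

definition gapn :: "('a::{field,finite} \<Rightarrow> 'a) \<Rightarrow> bool" where
  "gapn G \<longleftrightarrow>
     (\<forall>a b. a \<noteq> 0 \<longrightarrow> card {X. (\<Sum>i\<in>prime_subfield. G (X + i * a)) = b} \<le> CHAR('a))"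

end

theory Submission
  imports Defs "HOL-Computational_Algebra.Polynomial"
begin

text \<open>
  Let \<open>K\<close> be the prime subfield and \<open>D\<^sub>d x = (\<Sum>i\<in>K. (x + i) ^ d)\<close>. A function is GAPN iff each of its
  generalized derivatives in a direction \<open>a \<noteq> 0\<close> separates the cosets of \<open>a K\<close>; for \<open>X ^ d\<close> this
  derivative is \<open>a ^ d * D\<^sub>d (X / a)\<close>. Over the field with \<open>p ^ 2\<close> elements, \<open>x + x ^ p\<close> lies in
  \<open>K\<close>, so \<open>(D\<^sub>d x) ^ p = D\<^sub>d (- x) = (- 1) ^ d * D\<^sub>d x\<close>; in particular \<open>d1\<close> is odd. If the derivative
  of \<open>G\<close> took equal values on two cosets, then \<open>u = a ^ (d1 - d2) * c\<close> with \<open>c ^ p = c\<close> if \<open>d2\<close> is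
  odd and \<open>c ^ p = - c\<close> if \<open>d2\<close> is even. Elements of \<open>K\<close> are norms, i.e. \<open>(p + 1)\<close>-th powers, and
  if \<open>c ^ p = - c\<close>, then \<open>c ^ 2 \<in> K\<close>; so \<open>c\<close>, hence \<open>u\<close>, would be a square or an \<open>N\<close>-th power.
\<close>

section \<open>Finite fields and their prime subfields\<close>

lemma prime_CHAR_finite: "prime CHAR('a::{field,finite})"
  by (simp add: prime_CHAR_semidom finite_imp_CHAR_pos)

text \<open>Multiplication by a nonzero \<open>x\<close> permutes the nonzero elements, so comparing
  the products over both sides gives \<open>x ^ (CARD('a) - 1) = 1\<close>.\<close>

lemma power_CARD_eq_self:
  fixes x :: "'a::{field,finite}"
  shows "x ^ CARD('a) = x"
proof (cases "x = 0")
  case False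
  have "x ^ (CARD('a) - 1) * \<Prod>(UNIV - {0}) = (\<Prod>y\<in>UNIV - {0}. x * y)"
    by (simp add: prod.distrib)
  also have "\<dots> = \<Prod>(UNIV - {0})"
    by (rule prod.reindex_bij_witness[of _ "\<lambda>y. y / x" "\<lambda>y. x * y"]) (use False in auto)
  finally have "x ^ (CARD('a) - 1) = 1"
    by simp
  then show ?thesis
    by (metis finite_UNIV_card_ge_0 finite_class.finite_UNIV power_minus_mult
        mult_1)
qed (simp add: power_0_left)

lemma card_power_eq_le:
  fixes c :: "'a::idom"
  assumes "n > 0"
  shows "card {x. x ^ n = c} \<le> n"
proof -
  let ?P = "monom 1 n + [:- c:]"
  have deg: "degree ?P = n"
    using assms by (simp add: degree_add_eq_left degree_monom_eq)
  then have "?P \<noteq> 0"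
    using assms by (metis degree_0 less_irrefl)
  from card_poly_roots_bound[OF this] show ?thesis
    by (simp add: deg poly_monom)
qed

lemma card_prime_subfield: "card (prime_subfield :: 'a::{field,finite} set) = CHAR('a)"
proof -
  let ?p = "CHAR('a)"
  have p: "?p > 0"
    by (simp add: finite_imp_CHAR_pos)
  have "(of_int n :: 'a) \<in> of_nat ` {..<?p}" for n
  proof
    have "(of_int n :: 'a) = of_int (n mod int ?p)"
      by (simp add: of_int_eq_iff_cong_CHAR)
    then show "(of_int n :: 'a) = of_nat (nat (n mod int ?p))"
      using p by (simp add: of_nat_nat)
    show "nat (n mod int ?p) \<in> {..<?p}"
      using p by (simp add: nat_less_iff)
  qed
  moreover have "(of_nat n :: 'a) \<in> range of_int" for n
    by (metis of_int_of_nat_eq rangeI)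
  ultimately have "(prime_subfield :: 'a set) = of_nat ` {..<?p}"
    unfolding prime_subfield_def by auto
  moreover have "inj_on (of_nat :: nat \<Rightarrow> 'a) {..<?p}"
    by (auto simp: inj_on_def of_nat_eq_iff_cong_CHAR cong_def)
  ultimately show ?thesis
    by (metis card_image card_lessThan)
qed

lemma of_int_power_CHAR: "(of_int n :: 'a::{field,finite}) ^ CHAR('a) = of_int n"
proof -
  \<comment> \<open>Fermat's little theorem, by induction through the additivity of the Frobenius
    map.\<close>
  have *: "(of_nat m :: 'a) ^ CHAR('a) = of_nat m" for m
    by (induction m) (simp_all add: freshmans_dream prime_CHAR_finite power_0_left finite_imp_CHAR_pos)
  then show ?thesis
    by (cases n rule: int_cases2) (simp_all add: minus_power_prime_CHAR prime_CHAR_finite)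
qed

text \<open>The prime subfield supplies p roots of the polynomial X^p - X, whose degree leaves room
  for no others.\<close>

lemma mem_prime_subfield_iff:
  fixes x :: "'a::{field,finite}"
  shows "x \<in> prime_subfield \<longleftrightarrow> x ^ CHAR('a) = x"
proof -
  let ?p = "CHAR('a)"
  let ?P = "monom 1 ?p + [:0, - 1:] :: 'a poly"
  have p: "?p > 1"
    using prime_CHAR_finite prime_gt_1_nat by blast
  have deg: "degree ?P = ?p"
    using p by (simp add: degree_add_eq_left degree_monom_eq)
  then have "?P \<noteq> 0"
    using p by (metis degree_0 not_less_zero)
  from card_poly_roots_bound[OF this] have "card {x::'a. x ^ ?p = x} \<le> ?p"
    by (simp add: deg poly_monom)
  moreover have "prime_subfield \<subseteq> {x::'a. x ^ ?p = x}"
    by (auto simp: prime_subfield_def of_int_power_CHAR)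
  ultimately have "prime_subfield = {x::'a. x ^ ?p = x}"
    by (intro card_seteq) (auto simp: card_prime_subfield)
  then show ?thesis
    by blast
qed

lemma prime_subfield_add: "x \<in> prime_subfield \<Longrightarrow> y \<in> prime_subfield \<Longrightarrow> x + y \<in> prime_subfield"
  by (simp add: mem_prime_subfield_iff freshmans_dream prime_CHAR_finite)

lemma prime_subfield_uminus: "x \<in> prime_subfield \<Longrightarrow> - x \<in> prime_subfield"
  by (simp add: mem_prime_subfield_iff minus_power_prime_CHAR prime_CHAR_finite)

lemma prime_subfield_diff: "x \<in> prime_subfield \<Longrightarrow> y \<in> prime_subfield \<Longrightarrow> x - y \<in> prime_subfield"
  using prime_subfield_add[of x "- y"] prime_subfield_uminus[of y] by simp

section \<open>Generalized derivatives\<close>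

lemma sum_prime_subfield_shift:
  fixes f :: "'a::{field,finite} \<Rightarrow> 'b::comm_monoid_add"
  assumes "j \<in> prime_subfield"
  shows "(\<Sum>i\<in>prime_subfield. f (i + j)) = (\<Sum>i\<in>prime_subfield. f i)"
  by (rule sum.reindex_bij_witness[of _ "\<lambda>i. i - j" "\<lambda>i. i + j"])
     (use assms in \<open>auto intro: prime_subfield_add prime_subfield_diff\<close>)

text \<open>With X = a x, each solution set is a union of cosets of a K, and each coset has exactly
  p elements. So at most p solutions means at most one coset.\<close>

lemma gapn_iff:
  fixes G :: "'a::{field,finite} \<Rightarrow> 'a"
  shows "gapn G \<longleftrightarrow>
    (\<forall>a x y. a \<noteq> 0 \<longrightarrow>
       (\<Sum>i\<in>prime_subfield. G (a * (x + i))) = (\<Sum>i\<in>prime_subfield. G (a * (y + i))) \<longrightarrow>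
       x - y \<in> prime_subfield)" (is "_ \<longleftrightarrow> ?R")
proof
  let ?K = "prime_subfield :: 'a set"
  define S where "S a x = (\<Sum>i\<in>?K. G (a * (x + i)))" for a x
  have S: "(\<Sum>i\<in>?K. G (a * x + i * a)) = S a x" for a x
    by (simp add: S_def algebra_simps)
  have shift: "S a (x + j) = S a x" if "j \<in> ?K" for a x j
    using sum_prime_subfield_shift[OF that, of "\<lambda>i. G (a * (x + i))"]
    by (simp add: S_def ac_simps)
  show ?R if "gapn G"
  proof (intro allI impI, fold S_def, rule ccontr)
    fix a x y
    assume a: "a \<noteq> 0" and eq: "S a x = S a y" and neq: "x - y \<notin> ?K"
    let ?C = "\<lambda>z. (\<lambda>j. a * (z + j)) ` ?K"
    have card: "card (?C z) = CHAR('a)" for z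
      using a by (simp add: card_image inj_on_def card_prime_subfield)
    have "?C x \<inter> ?C y = {}"
    proof (safe, goal_cases)
      case (1 _ i j)
      then have "x + i = y + j"
        using a by simp
      then have "x - y = j - i"
        by (simp add: algebra_simps)
      then show ?case
        using 1 neq prime_subfield_diff by metis
    qed
    then have "card (?C x \<union> ?C y) = 2 * CHAR('a)"
      by (subst card_Un_disjoint) (simp_all add: card)
    moreover have "?C x \<union> ?C y \<subseteq> {X. (\<Sum>i\<in>?K. G (X + i * a)) = S a y}"
      by (auto simp: S shift eq)
    ultimately have "2 * CHAR('a) \<le> card {X. (\<Sum>i\<in>?K. G (X + i * a)) = S a y}"
      by (metis card_mono finite)
    also have "\<dots> \<le> CHAR('a)"
      using that a by (simp add: gapn_def)
    finally show False
      using finite_imp_CHAR_pos[where 'a = 'a] by simp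
  qed
  show "gapn G" if ?R
    unfolding gapn_def
  proof (intro allI impI)
    fix a b :: 'a
    assume a: "a \<noteq> 0"
    let ?A = "{X. (\<Sum>i\<in>?K. G (X + i * a)) = b}"
    show "card ?A \<le> CHAR('a)"
    proof (cases "?A = {}")
      case False
      then obtain Y where Y: "Y \<in> ?A"
        by blast
      have "(X - Y) / a \<in> ?K" if X: "X \<in> ?A" for X
      proof -
        have "S a (X / a) = S a (Y / a)"
          using X Y a S[of a "X / a"] S[of a "Y / a"] by simp
        then have "X / a - Y / a \<in> ?K"
          using \<open>?R\<close> a by (simp add: S_def)
        then show ?thesis
          by (simp add: diff_divide_distrib)
      qed
      then have "(\<lambda>X. (X - Y) / a) ` ?A \<subseteq> ?K"
        by blast
      moreover have "inj_on (\<lambda>X. (X - Y) / a) ?A"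
        using a by (auto simp: inj_on_def)
      ultimately show ?thesis
        using card_inj_on_le[of "\<lambda>X. (X - Y) / a" ?A ?K] by (simp add: card_prime_subfield)
    qed simp
  qed
qed

definition power_derivative :: "nat \<Rightarrow> 'a::{field,finite} \<Rightarrow> 'a" where
  "power_derivative d x = (\<Sum>i\<in>prime_subfield. (x + i) ^ d)"

lemma power_derivative_shift:
  "j \<in> prime_subfield \<Longrightarrow> power_derivative d (x + j) = power_derivative d x"
  using sum_prime_subfield_shift[of j "\<lambda>i. (x + i) ^ d"]
  by (simp add: power_derivative_def ac_simps)

lemma power_derivative_minus: "power_derivative d (- x) = (- 1) ^ d * power_derivative d x"
proof -
  have "power_derivative d (- x) = (\<Sum>i\<in>prime_subfield. (- (x + i)) ^ d)"
    unfolding power_derivative_def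
    by (rule sum.reindex_bij_witness[of _ uminus uminus]) (auto intro: prime_subfield_uminus)
  then show ?thesis
    by (simp only: power_derivative_def sum_distrib_left power_minus[of "_ + _"])
qed

text \<open>The Frobenius map is additive and multiplicative and fixes every \<open>i\<close> in the
  sum.\<close>

lemma power_derivative_power_CHAR:
  fixes x :: "'a::{field,finite}"
  shows "power_derivative d x ^ CHAR('a) = power_derivative d (x ^ CHAR('a))"
proof -
  have "((x + i) ^ d) ^ CHAR('a) = (x ^ CHAR('a) + i) ^ d" if "i \<in> prime_subfield" for i
  proof -
    have "((x + i) ^ d) ^ CHAR('a) = ((x + i) ^ CHAR('a)) ^ d"
      by (simp flip: power_mult add: mult.commute)
    then show ?thesis
      using that by (simp add: freshmans_dream prime_CHAR_finite mem_prime_subfield_iff)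
  qed
  then show ?thesis
    by (simp add: power_derivative_def freshmans_dream_sum prime_CHAR_finite)
qed

lemma sum_power_scaled:
  "(\<Sum>i\<in>prime_subfield. (a * (x + i)) ^ d) = a ^ d * power_derivative d x"
  by (simp add: power_derivative_def power_mult_distrib sum_distrib_left)

lemma gapn_power_iff:
  "gapn (\<lambda>X::'a::{field,finite}. X ^ d) \<longleftrightarrow>
    (\<forall>x y::'a. power_derivative d x = power_derivative d y \<longrightarrow> x - y \<in> prime_subfield)"
  \<comment> \<open>The factor \<open>a ^ d\<close> cancels, so the direction \<open>1\<close>
    stands for all others.\<close>
  unfolding gapn_iff sum_power_scaled by (auto intro: exI[of _ "1::'a"])

section \<open>Fields with \<open>p ^ 2\<close> elements\<close>

lemma CHAR_eq_of_CARD_prime_power: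
  assumes "prime p" "CARD('a::{field,finite}) = p ^ n"
  shows "CHAR('a) = p"
  using CHAR_dvd_CARD[where 'a = 'a] assms prime_CHAR_finite[where 'a = 'a]
  by (metis prime_dvd_power primes_dvd_imp_eq)

lemma frobenius_involution:
  fixes x :: "'a::{field,finite}"
  assumes "CARD('a) = CHAR('a) ^ 2"
  shows "(x ^ CHAR('a)) ^ CHAR('a) = x"
  using power_CARD_eq_self[of x] by (simp add: assms power2_eq_square power_mult)

lemma power_derivative_frobenius:
  fixes x :: "'a::{field,finite}"
  assumes "CARD('a) = CHAR('a) ^ 2"
  shows "power_derivative d x ^ CHAR('a) = (- 1) ^ d * power_derivative d x"
proof -
  have "x + x ^ CHAR('a) \<in> prime_subfield"
    by (simp add: mem_prime_subfield_iff freshmans_dream prime_CHAR_finite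
        frobenius_involution[OF assms] add.commute)
  from power_derivative_shift[OF this, of d "- x"] show ?thesis
    by (simp add: power_derivative_power_CHAR power_derivative_minus)
qed

text \<open>Counting: the p^2 - 1 nonzero elements split into fibres of the norm of size at most p +
  1, so the norm takes at least p - 1 nonzero values. These lie in K, which has only p - 1 nonzero
  elements.\<close>

lemma prime_subfield_is_norm:
  fixes x :: "'a::{field,finite}"
  assumes "CARD('a) = CHAR('a) ^ 2" and "x \<in> prime_subfield"
  shows "\<exists>v. x = v ^ (CHAR('a) + 1)"
proof (cases "x = 0")
  case False
  let ?p = "CHAR('a)" and ?U = "UNIV - {0::'a}"
  let ?f = "\<lambda>v::'a. v ^ (?p + 1)" and ?L = "prime_subfield - {0::'a}"
  have p: "?p > 0"
    by (simp add: finite_imp_CHAR_pos)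
  have "(?p - 1) * (?p + 1) = card ?U"
    by (simp add: assms(1) power2_eq_square algebra_simps)
  also have "\<dots> \<le> card (\<Union>y\<in>?f ` ?U. {v. ?f v = y})"
    by (intro card_mono) auto
  also have "\<dots> \<le> (\<Sum>y\<in>?f ` ?U. card {v. ?f v = y})"
    by (intro card_UN_le) auto
  also have "\<dots> \<le> (\<Sum>y\<in>?f ` ?U. ?p + 1)"
    by (intro sum_mono card_power_eq_le) auto
  also have "\<dots> = card (?f ` ?U) * (?p + 1)"
    by simp
  finally have "?p - 1 \<le> card (?f ` ?U)"
    by (simp only: mult_le_cancel2)
  also have "?p - 1 = card ?L"
    by (simp add: card_prime_subfield mem_prime_subfield_iff p power_0_left)
  finally have "card ?L \<le> card (?f ` ?U)" .
  \<comment> \<open>Frobenius merely swaps the two factors of the norm v * v^p.\<close>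
  moreover have "?f ` ?U \<subseteq> ?L"
    by (auto simp: mem_prime_subfield_iff power_mult_distrib frobenius_involution[OF assms(1)])
  ultimately have "?f ` ?U = ?L"
    by (intro card_seteq) auto
  then show ?thesis
    using assms(2) False by blast
qed (intro exI[of _ 0], simp)

lemma prime_subfield_is_power:
  fixes x :: "'a::{field,finite}"
  assumes "CARD('a) = CHAR('a) ^ 2" and "x \<in> prime_subfield" and "N dvd int CHAR('a) + 1"
  shows "\<exists>v. x = v powi N"
proof -
  obtain v where "x = v ^ (CHAR('a) + 1)"
    using prime_subfield_is_norm[OF assms(1,2)] by blast
  moreover obtain k where "int CHAR('a) + 1 = k * N"
    using assms(3) by (auto simp: dvd_def mult.commute)
  ultimately have "x = (v powi k) powi N"
    by (metis of_nat_1 of_nat_add power_int_mult power_int_of_nat)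
  then show ?thesis
    by blast
qed

text \<open>Here x^2 is fixed by Frobenius, hence an N-th power w^N. As N = 2 m + 1, x = x^N *
  (x^2)^(-m) is a product of N-th powers.\<close>

lemma frobenius_antifixed_is_power:
  fixes x :: "'a::{field,finite}"
  assumes "CARD('a) = CHAR('a) ^ 2" and "x ^ CHAR('a) = - x" and "x \<noteq> 0"
    and "N dvd int CHAR('a) + 1" and "odd N"
  shows "\<exists>v. x = v powi N"
proof -
  have "x ^ 2 \<in> prime_subfield"
    by (simp add: mem_prime_subfield_iff assms(2) flip: power_mult)
       (simp add: mult.commute power_mult assms(2))
  then obtain w where w: "x ^ 2 = w powi N"
    using prime_subfield_is_power[OF assms(1) _ assms(4)] by blast
  obtain m where m: "N = 2 * m + 1"
    using assms(5) by (rule oddE)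
  have "(x * w powi (- m)) powi N = x powi N * (w powi N) powi (- m)"
    by (simp add: power_int_mult_distrib mult.commute flip: power_int_mult)
  also have "\<dots> = x powi N * x powi (2 * (- m))"
    by (simp only: power_int_mult power_int_numeral w)
  also have "\<dots> = x powi (N + 2 * (- m))"
    using assms(3) by (intro power_int_add[symmetric] disjI1)
  also have "\<dots> = x"
    by (simp add: m)
  finally show ?thesis
    by metis
qed

text \<open>For even \<open>d\<close> the derivative takes equal values at z and -z, so 2 z, and
  with it every z, would lie in K.\<close>

lemma odd_if_gapn_power:
  assumes "CARD('a::{field,finite}) = CHAR('a) ^ 2" and "odd CHAR('a)"
    and "gapn (\<lambda>X::'a. X ^ d)"
  shows "odd d"
proof
  assume "even d"
  let ?p = "CHAR('a)"
  have p: "?p > 1"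
    using prime_CHAR_finite prime_gt_1_nat by blast
  have two: "(2::'a) \<noteq> 0"
    using assms(2) p of_nat_eq_0_iff_char_dvd[where 'a = 'a, of 2]
    by (metis (full_types) dvd_refl of_nat_numeral
        prime_CHAR_finite primes_dvd_imp_eq two_is_prime_nat)
  have "z \<in> prime_subfield" for z :: 'a
  proof -
    have "power_derivative d z = power_derivative d (- z)"
      using \<open>even d\<close> by (simp add: power_derivative_minus)
    then have "z - (- z) \<in> prime_subfield"
      using assms(3) unfolding gapn_power_iff by blast
    then have "(2 * z) ^ ?p = 2 * z"
      by (simp only: mem_prime_subfield_iff diff_minus_eq_add mult_2)
    moreover have "(2::'a) ^ ?p = 2"
      using of_int_power_CHAR[where 'a = 'a, of 2] by simp
    ultimately show ?thesis
      using two by (simp add: mem_prime_subfield_iff power_mult_distrib)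
  qed
  then have "(prime_subfield :: 'a set) = UNIV"
    by blast
  then have "?p ^ 2 = ?p"
    using card_prime_subfield[where 'a = 'a] assms(1) by simp
  then show False
    using p by (simp add: power2_eq_square)
qed

theorem theorem1:
  fixes p d1 d2 :: nat and u :: "'a::{field,finite}"
  assumes "prime p" and "odd p"
    and "CARD('a) = p ^ 2"
    and "d1 \<in> {1..p ^ 2 - 1}" and "d2 \<in> {1..p ^ 2 - 1}"
    and "gapn (\<lambda>X::'a. X ^ d1)"
    and "u \<noteq> 0"
    and "(odd d2 \<and> \<not> (\<exists>v. u = v ^ 2)) \<or>
         (even d2 \<and> (\<exists>N::int. odd N \<and> N dvd int p + 1 \<and> N dvd int d2 - int d1 \<and>
            \<not> (\<exists>v. u = v powi N)))"
  shows "gapn (\<lambda>X::'a. X ^ d1 + u * X ^ d2)"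
proof (rule ccontr)
  assume not_gapn: "\<not> ?thesis"
  let ?D = "power_derivative :: nat \<Rightarrow> 'a \<Rightarrow> 'a"
  have p: "CHAR('a) = p"
    by (rule CHAR_eq_of_CARD_prime_power) fact+
  have sq: "CARD('a) = CHAR('a) ^ 2"
    using assms(3) p by simp
  have odd_d1: "odd d1"
    using odd_if_gapn_power[OF sq _ assms(6)] p \<open>odd p\<close> by simp
  have deriv: "(\<Sum>i\<in>prime_subfield. (a * (x + i)) ^ d1 + u * (a * (x + i)) ^ d2)
      = a ^ d1 * ?D d1 x + u * (a ^ d2 * ?D d2 x)" for a x
    by (simp add: sum.distrib sum_power_scaled flip: sum_distrib_left)
  obtain a x y where a: "a \<noteq> 0" and xy: "x - y \<notin> prime_subfield"
    and eq: "a ^ d1 * ?D d1 x + u * (a ^ d2 * ?D d2 x) = a ^ d1 * ?D d1 y + u * (a ^ d2 * ?D d2 y)"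
    using not_gapn unfolding gapn_iff deriv by blast
  \<comment> \<open>The differences are taken in opposite orders so that \<open>AB\<close> carries
    no sign.\<close>
  define A where "A = ?D d1 x - ?D d1 y"
  define B where "B = ?D d2 y - ?D d2 x"
  have "A \<noteq> 0"
    using assms(6) xy by (auto simp: gapn_power_iff A_def)
  have AB: "a ^ d1 * A = u * (a ^ d2 * B)"
    using eq by (simp add: A_def B_def algebra_simps)
  with \<open>A \<noteq> 0\<close> a have "B \<noteq> 0"
    by auto
  define c where "c = A / B"
  have "c \<noteq> 0"
    using \<open>A \<noteq> 0\<close> \<open>B \<noteq> 0\<close> by (simp add: c_def)
  have diff_power: "(r - s) ^ p = r ^ p - s ^ p" for r s :: 'a
    using freshmans_dream[OF prime_CHAR_finite p[symmetric], of "r - s" s] by simp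
  have frob: "?D d z ^ p = (- 1) ^ d * ?D d z" for d z
    using power_derivative_frobenius[OF sq] p by simp
  \<comment> \<open>The minus sign comes from the odd \<open>d1\<close>. Thus Frobenius fixes
    \<open>c\<close> for odd \<open>d2\<close> and negates it for even \<open>d2\<close>.\<close>
  have c_frob: "c ^ p = - ((- 1) ^ d2 * c)"
  proof -
    have "A ^ p = - A"
      using odd_d1 by (simp add: A_def diff_power frob)
    moreover have "B ^ p = (- 1) ^ d2 * B"
      by (simp add: B_def diff_power frob right_diff_distrib)
    ultimately show ?thesis
      by (cases "even d2") (simp_all add: c_def power_divide)
  qed
  \<comment> \<open>An integer exponent, since \<open>d1\<close> may be smaller than
    \<open>d2\<close>.\<close>
  have u: "u = a powi (int d1 - int d2) * c"
    using AB a \<open>B \<noteq> 0\<close> by (simp add: c_def power_int_diff field_simps)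
  have u_power: "\<exists>v. u = v powi N" if "N dvd int d1 - int d2" "c = w powi N" for N w
  proof -
    obtain k where k: "int d1 - int d2 = k * N"
      using \<open>N dvd int d1 - int d2\<close> by (auto simp: dvd_def mult.commute)
    then have "u = (a powi k * w) powi N"
      by (simp only: u k that(2) power_int_mult power_int_mult_distrib)
    then show ?thesis
      by blast
  qed
  from assms(8) show False
  proof (elim disjE conjE exE)
    assume "odd d2" and not_square: "\<not> (\<exists>v. u = v ^ 2)"
    from c_frob \<open>odd d2\<close> have "c \<in> prime_subfield"
      by (simp add: mem_prime_subfield_iff p)
    \<comment> \<open>The exponent 2 divides p + 1 because p is odd.\<close>
    then obtain w where "c = w powi 2"
      using prime_subfield_is_power[OF sq, of c 2] p \<open>odd p\<close> by auto
    \<comment> \<open>Both \<open>d1\<close> and \<open>d2\<close> are odd, so 2 also divides their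
      difference and \<open>u\<close> would be a square.\<close>
    then show False
      using u_power[of 2] not_square odd_d1 \<open>odd d2\<close> by auto
  next
    fix N :: int
    assume "even d2" "odd N" "N dvd int p + 1" "N dvd int d2 - int d1"
      and not_power: "\<not> (\<exists>v. u = v powi N)"
    from c_frob \<open>even d2\<close> have "c ^ CHAR('a) = - c"
      by (simp add: p)
    then obtain w where "c = w powi N"
      using frobenius_antifixed_is_power[OF sq _ \<open>c \<noteq> 0\<close>] \<open>odd N\<close> \<open>N dvd int p + 1\<close> p by blast
    then show False
      using u_power not_power \<open>N dvd int d2 - int d1\<close> by (metis dvd_diff_commute)
  qed
qed

end
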